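(* Let $f$ be a transcendental entire function with $F(f)\neq\emptyset$ and $f\in\Delta$. Suppose that there exist positive constants $M_0$, $C_1>1$, $C_2>1$ such that $$[M_0,\infty)\subset\{r>0:\ \log M(C_1r,f)\ge C_2\log M(r,f)\}.$$ Then $F(f)$ is strongly uniformly bounded, i.e. $B_1(f)<\infty$.
   Context: For a transcendental entire function $f$, the Fatou set $F(f)$ is the set of $z\in\mathbb C$ such that the sequence of iterates $\{f^n\}_{n\ge1}$ is normal (in the sense of Montel, with the constant limit $\infty$ allowed) in some neighborhood of $z$. Write $M(r,f)=\max\{|f(z)|:|z|=r\}$ and $m(r,f)=\min\{|f(z)|:|z|=r\}$. For $E\subset[1,\infty)$ the upper logarithmic density is $\overline{\log\mathrm{dens}}\,E=\limsup_{R\to\infty}\frac{1}{\log R}\int_{E\cap(1,R)}\frac{dt}{t}$. A transcendental entire function $f$ belongs to the class $\Delta$ if there exist constants $\varepsilon_1,\varepsilon_2$ with $0<\varepsilon_1,\varepsilon_2<1$ such that $\overline{\log\mathrm{dens}}\,E(f)\le\varepsilon_1$, where $E(f)=\{r>1:\log m(r,f)\le\varepsilon_2\log M(r,f)\}$ (with $\log 0=-\infty$). Define $$B_1(f)=\sup_U\frac{\sup_{z\in U}\log(|z|+3)}{\inf_{w\in U}\log(|w|+3)},$$ where $\sup_U$ is over all connected components $U$ of $F(f)$ (a term is $+\infty$ if $U$ is unbounded). $F(f)$ is called strongly uniformly bounded if $B_1(f)<\infty$. *)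

theory Defs
  imports "HOL-Complex_Analysis.Complex_Analysis" "HOL-Computational_Algebra.Polynomial"
begin

definition transcendental_entire :: "(complex \<Rightarrow> complex) \<Rightarrow> bool" where
  "transcendental_entire f \<longleftrightarrow>
     f holomorphic_on UNIV \<and> \<not> (\<exists>p :: complex poly. \<forall>z. f z = poly p z)"

(* The members of the family are intended to be holomorphic on the open set V.  The second
   alternative is locally uniform convergence to the constant limit infinity. *)
definition normal_family :: "complex set \<Rightarrow> (complex \<Rightarrow> complex) set \<Rightarrow> bool" where
  "normal_family V \<F> \<longleftrightarrow>
     (\<forall>F :: nat \<Rightarrow> complex \<Rightarrow> complex. range F \<subseteq> \<F> \<longrightarrow>
        (\<exists>r :: nat \<Rightarrow> nat. strict_mono r \<and>
           ((\<exists>g. g holomorphic_on V \<and>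
               (\<forall>K. compact K \<and> K \<subseteq> V \<longrightarrow> uniform_limit K (F \<circ> r) g sequentially)) \<or>
            (\<forall>K. compact K \<and> K \<subseteq> V \<longrightarrow>
               (\<forall>B :: real. \<forall>\<^sub>F n in sequentially. \<forall>z\<in>K. B < cmod (F (r n) z))))))"

definition fatou_set :: "(complex \<Rightarrow> complex) \<Rightarrow> complex set" where
  "fatou_set f =
     {z. \<exists>V. open V \<and> z \<in> V \<and> normal_family V {f ^^ n | n :: nat. n \<ge> 1}}"

(* For continuous f and r \<ge> 0 the circle is compact and nonempty, so the supremum and the
   infimum are attained. *)
definition max_modulus :: "real \<Rightarrow> (complex \<Rightarrow> complex) \<Rightarrow> real" where
  "max_modulus r f = (SUP z\<in>sphere 0 r. cmod (f z))"

definition min_modulus :: "real \<Rightarrow> (complex \<Rightarrow> complex) \<Rightarrow> real" where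
  "min_modulus r f = (INF z\<in>sphere 0 r. cmod (f z))"

(* Since ln 0 = 0 for the real logarithm, the convention log 0 = -\<infinity> needs the extended reals. *)
definition ext_ln :: "real \<Rightarrow> ereal" where
  "ext_ln x = (if x > 0 then ereal (ln x) else - \<infinity>)"

definition upper_log_dens :: "real set \<Rightarrow> ereal" where
  "upper_log_dens E =
     Limsup at_top (\<lambda>R :: real. ereal (1 / ln R * (LINT t : E \<inter> {1<..<R} | lebesgue. 1 / t)))"

definition exceptional_radii :: "(complex \<Rightarrow> complex) \<Rightarrow> real \<Rightarrow> real set" where
  "exceptional_radii f \<epsilon> =
     {r. r > 1 \<and> ext_ln (min_modulus r f) \<le> ereal \<epsilon> * ext_ln (max_modulus r f)}"

definition class_Delta :: "(complex \<Rightarrow> complex) set" where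
  "class_Delta =
     {f. transcendental_entire f \<and>
         (\<exists>\<epsilon>\<^sub>1 \<epsilon>\<^sub>2 :: real. 0 < \<epsilon>\<^sub>1 \<and> \<epsilon>\<^sub>1 < 1 \<and> 0 < \<epsilon>\<^sub>2 \<and> \<epsilon>\<^sub>2 < 1 \<and>
            upper_log_dens (exceptional_radii f \<epsilon>\<^sub>2) \<le> ereal \<epsilon>\<^sub>1)}"

(* For an unbounded component the numerator is \<infinity> while the denominator is a real number
   \<ge> ln 3 > 0, so the quotient is \<infinity>. *)
definition B1 :: "(complex \<Rightarrow> complex) \<Rightarrow> ereal" where
  "B1 f = (SUP U\<in>components (fatou_set f).
             (SUP z\<in>U. ereal (ln (cmod z + 3))) / (INF w\<in>U. ereal (ln (cmod w + 3))))"

definition strongly_uniformly_bounded_fatou :: "(complex \<Rightarrow> complex) \<Rightarrow> bool" where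
  "strongly_uniformly_bounded_fatou f \<longleftrightarrow> B1 f < \<infinity>"

end

theory Submission
  imports Defs
begin

text \<open>
  Suppose that a component \<open>U\<close> of \<open>F(f)\<close> contains points of modulus at most \<open>r\<^sub>0\<close> and at least
  \<open>r\<^sub>0\<^sup>S\<close>, with \<open>r\<^sub>0\<close> large, and let \<open>\<Gamma> \<subseteq> U\<close> be a path joining them. Put
  \<open>r\<^bsub>n+1\<^esub> = M(r\<^sub>n, f)\<close>. Inductively, \<open>f\<^sup>n(\<Gamma>)\<close> meets both \<open>\<bar>z\<bar> \<le> r\<^sub>n\<close> and \<open>\<bar>z\<bar> \<ge> r\<^sub>n\<^sup>S\<close>, hence also the
  circle \<open>\<bar>z\<bar> = t\<close> for some \<open>t \<in> (r\<^sub>n\<^sup>2, r\<^sub>n\<^sup>S)\<close> outside \<open>E(f)\<close>; such a \<open>t\<close> exists by the density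
  assumption if \<open>S\<close> is large. There \<open>\<bar>f\<bar> \<ge> M(r\<^sub>n\<^sup>2, f)\<^sup>\<epsilon>\<close>, and the growth condition makes
  \<open>log M(r\<^sup>2, f) / log M(r, f)\<close> tend to infinity. So the induction proceeds, and the ratio of the
  values of \<open>log \<bar>f\<^bsup>n+1\<^esup>\<bar>\<close> at two points of \<open>\<Gamma>\<close> is unbounded in \<open>n\<close>. But iterates in \<open>U\<close> escape to infinity
  along a subsequence, so \<open>log \<bar>f\<^sup>n\<bar>\<close> is eventually positive and harmonic near \<open>\<Gamma>\<close>, and Harnack's
  inequality bounds this ratio.
\<close>

section \<open>Escape to infinity on the Fatou set\<close>

text \<open>Harnack's inequality for the positive harmonic function \<open>ln (cmod (g w))\<close>:
  at half the radius the constant is (1 + 1/2) / (1 - 1/2) = 3. A holomorphic logarithm of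
  \<open>g\<close> maps into the right half-plane, which reduces the claim to the Schwarz
  lemma.\<close>

lemma Harnack_ln_cmod:
  assumes holo: "g holomorphic_on ball z \<rho>"
    and gt1: "\<And>w. w \<in> ball z \<rho> \<Longrightarrow> 1 < cmod (g w)"
    and w: "dist z w < \<rho> / 2"
  shows "ln (cmod (g w)) \<le> 3 * ln (cmod (g z))"
proof -
  have \<rho>: "\<rho> > 0"
    using w zero_le_dist[of z w] by linarith
  have nz: "g x \<noteq> 0" if "x \<in> ball z \<rho>" for x
    using gt1[OF that] by auto
  obtain h where h: "h holomorphic_on ball z \<rho>" "\<And>x. x \<in> ball z \<rho> \<Longrightarrow> exp (h x) = g x"
    using holomorphic_logarithm_exists[OF convex_ball open_ball holo nz, of z] \<rho> by auto
  have Re_h: "Re (h x) = ln (cmod (g x))" if "x \<in> ball z \<rho>" for x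
    using h(2)[OF that] by (metis ln_exp norm_exp_eq_Re)
  have Re_pos: "Re (h x) > 0" if "x \<in> ball z \<rho>" for x
    using Re_h[OF that] ln_gt_zero[OF gt1[OF that]] by simp
  \<comment> \<open>\<open>(h - h z) / (h + cnj (h z))\<close> maps the ball into the unit disc; apply the Schwarz lemma.\<close>
  define a where "a = h z"
  have a: "Re a > 0"
    using Re_pos[of z] \<rho> by (simp add: a_def)
  define \<phi> where "\<phi> = (\<lambda>\<zeta>. h (z + of_real \<rho> * \<zeta>))"
  define k where "k = (\<lambda>\<zeta>. (\<phi> \<zeta> - a) / (\<phi> \<zeta> + cnj a))"
  have in_ball: "z + of_real \<rho> * \<zeta> \<in> ball z \<rho>" if "cmod \<zeta> < 1" for \<zeta>
    using that \<rho> by (simp add: dist_norm norm_mult)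
  have \<phi>_pos: "Re (\<phi> \<zeta>) > 0" if "cmod \<zeta> < 1" for \<zeta>
    using Re_pos[OF in_ball[OF that]] by (simp add: \<phi>_def)
  have denom: "\<phi> \<zeta> + cnj a \<noteq> 0" if "cmod \<zeta> < 1" for \<zeta>
    using \<phi>_pos[OF that] a by (auto simp: complex_eq_iff)
  \<comment> \<open>A point of the right half-plane is closer to \<open>a\<close> than to its mirror
    image \<open>- cnj a\<close>; this identity measures by how much.\<close>
  have sq: "(cmod (\<phi> \<zeta> + cnj a))\<^sup>2 - (cmod (\<phi> \<zeta> - a))\<^sup>2 = 4 * Re a * Re (\<phi> \<zeta>)" for \<zeta>
    by (simp add: cmod_power2) (simp add: power2_eq_square algebra_simps)
  have k_lt: "cmod (k \<zeta>) < 1" if "cmod \<zeta> < 1" for \<zeta>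
  proof -
    have "0 < 4 * Re a * Re (\<phi> \<zeta>)"
      using a \<phi>_pos[OF that] by simp
    then have "(cmod (\<phi> \<zeta> - a))\<^sup>2 < (cmod (\<phi> \<zeta> + cnj a))\<^sup>2"
      using sq[of \<zeta>] by linarith
    then have "cmod (\<phi> \<zeta> - a) < cmod (\<phi> \<zeta> + cnj a)"
      by (rule power_less_imp_less_base) simp
    then show ?thesis
      using denom[OF that] by (simp add: k_def norm_divide)
  qed
  have \<phi>_holo: "\<phi> holomorphic_on ball 0 1"
    unfolding \<phi>_def
    by (rule holomorphic_on_compose_gen[OF _ h(1), unfolded o_def])
       (use in_ball in \<open>auto intro!: holomorphic_intros\<close>)
  have k_holo: "k holomorphic_on ball 0 1"
    unfolding k_def using denom by (intro holomorphic_intros \<phi>_holo) auto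
  have k0: "k 0 = 0"
    by (simp add: k_def \<phi>_def a_def)
  define \<xi> where "\<xi> = (w - z) / of_real \<rho>"
  have \<xi>: "cmod \<xi> < 1 / 2"
    using w \<rho> by (simp add: \<xi>_def norm_divide dist_norm norm_minus_commute field_simps)
  then have \<xi>1: "cmod \<xi> < 1"
    by simp
  have "cmod (k \<xi>) \<le> cmod \<xi>"
    using Schwarz_Lemma(1)[OF k_holo k0 k_lt \<xi>1] by simp
  with \<xi> have "cmod (k \<xi>) \<le> 1 / 2"
    by simp
  then have "cmod (\<phi> \<xi> - a) \<le> cmod (\<phi> \<xi> + cnj a) / 2"
    using denom[OF \<xi>1] by (simp add: k_def norm_divide field_simps)
  then have "(cmod (\<phi> \<xi> - a))\<^sup>2 \<le> (cmod (\<phi> \<xi> + cnj a) / 2)\<^sup>2"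
    by (rule power_mono) simp
  then have "4 * ((Re (\<phi> \<xi>) - Re a)\<^sup>2 + (Im (\<phi> \<xi>) - Im a)\<^sup>2)
      \<le> (Re (\<phi> \<xi>) + Re a)\<^sup>2 + (Im (\<phi> \<xi>) - Im a)\<^sup>2"
    by (simp add: cmod_power2 power_divide)
  \<comment> \<open>The square of the imaginary part has factor 4 on the left and 1 on the right, so
    it may be dropped.\<close>
  then have "4 * (Re (\<phi> \<xi>) - Re a)\<^sup>2 \<le> (Re (\<phi> \<xi>) + Re a)\<^sup>2"
    using zero_le_power2[of "Im (\<phi> \<xi>) - Im a"] unfolding distrib_left by linarith
  then have "(2 * (Re (\<phi> \<xi>) - Re a))\<^sup>2 \<le> (Re (\<phi> \<xi>) + Re a)\<^sup>2"
    by (subst power_mult_distrib) simp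
  then have "2 * (Re (\<phi> \<xi>) - Re a) \<le> Re (\<phi> \<xi>) + Re a"
    by (rule power2_le_imp_le) (use a \<phi>_pos[OF \<xi>1] in linarith)
  then have "Re (\<phi> \<xi>) \<le> 3 * Re a"
    by simp
  moreover have "\<phi> \<xi> = h w"
    using \<rho> by (simp add: \<phi>_def \<xi>_def)
  moreover have "w \<in> ball z \<rho>" "z \<in> ball z \<rho>"
    using w \<rho> by auto
  ultimately show ?thesis
    using Re_h by (simp add: a_def)
qed

text \<open>If the bound failed for infinitely many \<open>k\<close>, normality would apply to a
  subsequence of these. A finite limit is bounded on \<open>K\<close> and contradicts the escape of
  the points \<open>q k\<close>, which may move with \<open>k\<close>; the limit infinity
  contradicts the failure of the bound.\<close>

lemma normal_family_escape:
  assumes nf: "normal_family V \<F>" and K: "compact K" "K \<subseteq> V"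
    and F: "\<And>k. F k \<in> \<F>" and q: "\<And>k. q k \<in> K"
    and esc: "filterlim (\<lambda>k. cmod (F k (q k))) at_top sequentially"
  shows "\<forall>\<^sub>F k in sequentially. \<forall>z\<in>K. B < cmod (F k z)"
proof (rule ccontr)
  assume "\<not> ?thesis"
  then have "infinite {k. \<not> (\<forall>z\<in>K. B < cmod (F k z))}"
    by (simp add: eventually_cofinite flip: cofinite_eq_sequentially)
  then obtain s :: "nat \<Rightarrow> nat" where s: "strict_mono s"
    "\<And>j. s j \<in> {k. \<not> (\<forall>z\<in>K. B < cmod (F k z))}"
    using infinite_enumerate by blast
  have "range (F \<circ> s) \<subseteq> \<F>"
    using F by auto
  then obtain r :: "nat \<Rightarrow> nat" where r: "strict_mono r"
    and alt: "(\<exists>g. g holomorphic_on V \<and>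
               (\<forall>K. compact K \<and> K \<subseteq> V \<longrightarrow> uniform_limit K ((F \<circ> s) \<circ> r) g sequentially)) \<or>
            (\<forall>K. compact K \<and> K \<subseteq> V \<longrightarrow>
               (\<forall>B :: real. \<forall>\<^sub>F n in sequentially. \<forall>z\<in>K. B < cmod ((F \<circ> s) (r n) z)))"
    using nf[unfolded normal_family_def, rule_format, of "F \<circ> s"] by blast
  from alt show False
  proof
    assume "\<exists>g. g holomorphic_on V \<and>
               (\<forall>K. compact K \<and> K \<subseteq> V \<longrightarrow> uniform_limit K ((F \<circ> s) \<circ> r) g sequentially)"
    then obtain g where g: "g holomorphic_on V" "uniform_limit K ((F \<circ> s) \<circ> r) g sequentially"
      using K by blast
    have "compact (g ` K)"
      using g(1) K holomorphic_on_imp_continuous_on continuous_on_subset compact_continuous_image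
      by blast
    then obtain c where c: "\<And>z. z \<in> K \<Longrightarrow> cmod (g z) \<le> c"
      using compact_imp_bounded bounded_iff by (metis image_eqI)
    have "\<forall>\<^sub>F n in sequentially. \<forall>z\<in>K. dist (((F \<circ> s) \<circ> r) n z) (g z) < 1"
      using uniform_limitD[OF g(2)] by simp
    moreover have "filterlim (\<lambda>n. s (r n)) sequentially sequentially"
      using filterlim_compose filterlim_subseq r s(1) by blast
    then have "filterlim (\<lambda>n. cmod (F (s (r n)) (q (s (r n))))) at_top sequentially"
      using filterlim_compose[OF esc] by blast
    then have "\<forall>\<^sub>F n in sequentially. c + 1 < cmod (F (s (r n)) (q (s (r n))))"
      unfolding filterlim_at_top_dense by blast
    ultimately have "\<forall>\<^sub>F n in sequentially. False"
    proof eventually_elim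
      case (elim n)
      let ?w = "q (s (r n))"
      have "dist (F (s (r n)) ?w) (g ?w) < 1"
        using elim(1) q by simp
      then have "cmod (F (s (r n)) ?w) < 1 + cmod (g ?w)"
        by (smt (verit) dist_norm norm_triangle_sub)
      with c[OF q] elim(2) show False
        by (smt (verit))
    qed
    then show False
      by simp
  next
    assume "\<forall>K. compact K \<and> K \<subseteq> V \<longrightarrow>
               (\<forall>B :: real. \<forall>\<^sub>F n in sequentially. \<forall>z\<in>K. B < cmod ((F \<circ> s) (r n) z))"
    then have "\<forall>\<^sub>F n in sequentially. \<forall>z\<in>K. B < cmod (F (s (r n)) z)"
      using K by simp
    then obtain n where "\<forall>z\<in>K. B < cmod (F (s (r n)) z)"
      using eventually_happens' by force
    with s(2)[of "r n"] show False
      by force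
  qed
qed

lemma holomorphic_funpow:
  fixes f :: "complex \<Rightarrow> complex"
  assumes "f holomorphic_on UNIV"
  shows "(f ^^ n) holomorphic_on UNIV"
proof (induction n)
  case (Suc n)
  then show ?case
    using holomorphic_on_compose[OF Suc holomorphic_on_subset[OF assms subset_UNIV]]
    by (simp only: funpow.simps)
qed (simp add: id_def)

lemma open_fatou_set: "open (fatou_set f)"
proof (rule Topological_Spaces.openI)
  fix z assume "z \<in> fatou_set f"
  then obtain V where "open V" "z \<in> V" "normal_family V {f ^^ n | n :: nat. n \<ge> 1}"
    unfolding fatou_set_def by blast
  then show "\<exists>T. open T \<and> z \<in> T \<and> T \<subseteq> fatou_set f"
    unfolding fatou_set_def by blast
qed

text \<open>Normality makes escape uniform near \<open>z\<close>, and Harnack then compares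
  logarithms there. The radius \<open>\<delta>\<close> depends neither on the iterates chosen nor on
  the points \<open>x k\<close>, so the result can be applied to a convergent sequence of
  points.\<close>

lemma fatou_escape_local:
  assumes holo: "f holomorphic_on UNIV" and z: "z \<in> fatou_set f"
  obtains \<delta> where "\<delta> > 0"
    "\<And>r x. (\<And>k. r k \<ge> 1) \<Longrightarrow> (\<And>k. x k \<in> ball z \<delta>) \<Longrightarrow>
       filterlim (\<lambda>k. cmod ((f ^^ r k) (x k))) at_top sequentially \<Longrightarrow>
       (\<forall>B. \<forall>\<^sub>F k in sequentially. \<forall>w\<in>ball z \<delta>. B < cmod ((f ^^ r k) w)) \<and>
       (\<forall>\<^sub>F k in sequentially. \<forall>w\<in>ball z \<delta>. \<forall>w'\<in>ball z \<delta>.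
          ln (cmod ((f ^^ r k) w)) \<le> 3 * ln (cmod ((f ^^ r k) w')))"
proof -
  obtain V where V: "open V" "z \<in> V" and nf: "normal_family V {f ^^ n | n :: nat. n \<ge> 1}"
    using z unfolding fatou_set_def by blast
  obtain \<rho> where \<rho>: "\<rho> > 0" "cball z \<rho> \<subseteq> V"
    using V open_contains_cball by blast
  show thesis
  \<comment> \<open>Two points of this ball are less than \<open>\<rho> / 4\<close> apart, half the
    radius of \<open>ball w' (\<rho> / 2)\<close>, which still lies in
    \<open>cball z \<rho>\<close>.\<close>
  proof (rule that[of "\<rho> / 8"])
    fix r :: "nat \<Rightarrow> nat" and x
    assume r: "\<And>k. r k \<ge> 1" and x: "\<And>k. x k \<in> ball z (\<rho> / 8)"
      and esc: "filterlim (\<lambda>k. cmod ((f ^^ r k) (x k))) at_top sequentially"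
    have x': "x k \<in> cball z \<rho>" for k
      using x[of k] \<rho>(1) by auto
    have "f ^^ r k \<in> {f ^^ n | n :: nat. n \<ge> 1}" for k
      using r by blast
    note unif = normal_family_escape[where F = "\<lambda>k. f ^^ r k", OF nf compact_cball \<rho>(2) this x' esc]
    have 1: "\<forall>\<^sub>F k in sequentially. \<forall>w\<in>ball z (\<rho> / 8). B < cmod ((f ^^ r k) w)" for B
      using unif[of B] by eventually_elim (use \<rho>(1) in auto)
    have 2: "\<forall>\<^sub>F k in sequentially. \<forall>w\<in>ball z (\<rho> / 8). \<forall>w'\<in>ball z (\<rho> / 8).
          ln (cmod ((f ^^ r k) w)) \<le> 3 * ln (cmod ((f ^^ r k) w'))"
      \<comment> \<open>Modulus above 1 gives the positive logarithm that Harnack's inequality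
        requires.\<close>
      using unif[of 1]
    proof eventually_elim
      case (elim k)
      show ?case
      proof (intro ballI)
        fix w w' assume w: "w \<in> ball z (\<rho> / 8)" "w' \<in> ball z (\<rho> / 8)"
        have sub: "ball w' (\<rho> / 2) \<subseteq> cball z \<rho>"
        proof
          fix y assume "y \<in> ball w' (\<rho> / 2)"
          then show "y \<in> cball z \<rho>"
            using w(2) dist_triangle[of z y w'] \<rho>(1) by simp
        qed
        have "dist w' w < \<rho> / 2 / 2"
          using w dist_triangle2[of w' w z] by (simp add: dist_commute)
        moreover have "(f ^^ r k) holomorphic_on ball w' (\<rho> / 2)"
          using holomorphic_funpow[OF holo] by (rule holomorphic_on_subset) simp
        moreover have "1 < cmod ((f ^^ r k) y)" if "y \<in> ball w' (\<rho> / 2)" for y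
          using elim sub that by blast
        ultimately show "ln (cmod ((f ^^ r k) w)) \<le> 3 * ln (cmod ((f ^^ r k) w'))"
          by (intro Harnack_ln_cmod[where \<rho> = "\<rho> / 2"])
      qed
    qed
    show "(\<forall>B. \<forall>\<^sub>F k in sequentially. \<forall>w\<in>ball z (\<rho> / 8). B < cmod ((f ^^ r k) w)) \<and>
       (\<forall>\<^sub>F k in sequentially. \<forall>w\<in>ball z (\<rho> / 8). \<forall>w'\<in>ball z (\<rho> / 8).
          ln (cmod ((f ^^ r k) w)) \<le> 3 * ln (cmod ((f ^^ r k) w')))"
      using 1 2 by blast
  qed (use \<rho> in auto)
qed

text \<open>A Harnack chain from \<open>q\<close> to \<open>p\<close>, with connectedness in place
  of an explicit chain of discs: the local constants 3 multiply to some \<open>K\<close> that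
  depends on the two points but not on \<open>k\<close>.\<close>

lemma fatou_escape_comparable:
  assumes holo: "f holomorphic_on UNIV"
    and U: "open U" "connected U" "U \<subseteq> fatou_set f" and pq: "p \<in> U" "q \<in> U"
    and r: "\<And>k. r k \<ge> 1"
    and esc: "filterlim (\<lambda>k. cmod ((f ^^ r k) q)) at_top sequentially"
  obtains K where "K > 0" "filterlim (\<lambda>k. cmod ((f ^^ r k) p)) at_top sequentially"
    "\<forall>\<^sub>F k in sequentially. ln (cmod ((f ^^ r k) q)) \<le> K * ln (cmod ((f ^^ r k) p))"
proof -
  define esc where "esc = (\<lambda>x. filterlim (\<lambda>k. cmod ((f ^^ r k) x)) at_top sequentially)"
  \<comment> \<open>The premise \<open>esc x\<close> makes \<open>D\<close> vacuous at points that
    do not escape, so its transitivity and its local validity need no case distinction.\<close>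
  define D where "D = (\<lambda>x y. esc x \<longrightarrow> esc y \<and> (\<exists>K>0. \<forall>\<^sub>F k in sequentially.
     ln (cmod ((f ^^ r k) x)) \<le> K * ln (cmod ((f ^^ r k) y))))"
  have D_trans: "D x z" if D: "D x y" "D y z" for x y z
    unfolding D_def
  proof (intro impI)
    assume "esc x"
    with D(1) obtain K where y: "esc y" and K: "K > 0"
      "\<forall>\<^sub>F k in sequentially. ln (cmod ((f ^^ r k) x)) \<le> K * ln (cmod ((f ^^ r k) y))"
      unfolding D_def by blast
    from y D(2) obtain L where z: "esc z" and L: "L > 0"
      "\<forall>\<^sub>F k in sequentially. ln (cmod ((f ^^ r k) y)) \<le> L * ln (cmod ((f ^^ r k) z))"
      unfolding D_def by blast
    have "\<forall>\<^sub>F k in sequentially. ln (cmod ((f ^^ r k) x)) \<le> (K * L) * ln (cmod ((f ^^ r k) z))"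
      using K(2) L(2)
    proof eventually_elim
      case (elim k)
      show ?case
        using elim(1) mult_left_mono[OF elim(2) less_imp_le[OF K(1)]] by (simp only: mult.assoc)
    qed
    with z K(1) L(1) show "esc z \<and> (\<exists>K>0. \<forall>\<^sub>F k in sequentially.
        ln (cmod ((f ^^ r k) x)) \<le> K * ln (cmod ((f ^^ r k) z)))"
      using z K(1) L(1) by (intro conjI exI[of _ "K * L"] mult_pos_pos)
  qed
  \<comment> \<open>The symmetrised relation is transitive and holds near every point of
    \<open>U\<close>, so on the connected set \<open>U\<close> it holds throughout.\<close>
  have "D q p \<and> D p q"
  proof (rule connected_equivalence_relation[OF U(2) pq(2,1), where R = "\<lambda>x y. D x y \<and> D y x"])
    fix a assume a: "a \<in> U"
    with U(3) have "a \<in> fatou_set f"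
      by blast
    from fatou_escape_local[OF holo this] obtain \<delta> where \<delta>: "\<delta> > 0" and
      loc: "\<And>r x. (\<And>k. r k \<ge> 1) \<Longrightarrow> (\<And>k. x k \<in> ball a \<delta>) \<Longrightarrow>
       filterlim (\<lambda>k. cmod ((f ^^ r k) (x k))) at_top sequentially \<Longrightarrow>
       (\<forall>B. \<forall>\<^sub>F k in sequentially. \<forall>w\<in>ball a \<delta>. B < cmod ((f ^^ r k) w)) \<and>
       (\<forall>\<^sub>F k in sequentially. \<forall>w\<in>ball a \<delta>. \<forall>w'\<in>ball a \<delta>.
          ln (cmod ((f ^^ r k) w)) \<le> 3 * ln (cmod ((f ^^ r k) w')))"
      by blast
    have D_loc: "D x y" if xy: "x \<in> ball a \<delta>" "y \<in> ball a \<delta>" for x y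
      unfolding D_def
    proof
      assume "esc x"
      from loc[of r "\<lambda>_. x", OF r xy(1) this[unfolded esc_def]]
      have *: "\<And>B. \<forall>\<^sub>F k in sequentially. \<forall>w\<in>ball a \<delta>. B < cmod ((f ^^ r k) w)"
        "\<forall>\<^sub>F k in sequentially. \<forall>w\<in>ball a \<delta>. \<forall>w'\<in>ball a \<delta>.
          ln (cmod ((f ^^ r k) w)) \<le> 3 * ln (cmod ((f ^^ r k) w'))"
        by blast+
      have "\<forall>\<^sub>F k in sequentially. B < cmod ((f ^^ r k) y)" for B
        using *(1)[of B] by eventually_elim (use xy in blast)
      moreover have "\<forall>\<^sub>F k in sequentially. ln (cmod ((f ^^ r k) x)) \<le> 3 * ln (cmod ((f ^^ r k) y))"
        using *(2) by eventually_elim (use xy in blast)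
      ultimately show "esc y \<and> (\<exists>K>0. \<forall>\<^sub>F k in sequentially.
          ln (cmod ((f ^^ r k) x)) \<le> K * ln (cmod ((f ^^ r k) y)))"
        unfolding esc_def filterlim_at_top_dense by (intro conjI exI[of _ 3] allI) simp_all
    qed
    show "\<exists>T. openin (top_of_set U) T \<and> a \<in> T \<and> (\<forall>x\<in>T. D a x \<and> D x a)"
      using D_loc \<delta> a by (intro exI[of _ "U \<inter> ball a \<delta>"]) (auto simp: openin_open)
  qed (use D_trans in blast)+
  then have "esc p \<and> (\<exists>K>0. \<forall>\<^sub>F k in sequentially.
     ln (cmod ((f ^^ r k) q)) \<le> K * ln (cmod ((f ^^ r k) p)))"
    using esc unfolding D_def esc_def by blast
  then show thesis
    using that unfolding esc_def by blast
qed

section \<open>Maximum and minimum modulus\<close>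

lemma cmod_le_max_modulus_sphere:
  assumes "continuous_on UNIV f"
  shows "cmod (f z) \<le> max_modulus (cmod z) f"
proof -
  have "compact ((\<lambda>z. cmod (f z)) ` sphere 0 (cmod z))"
    using assms
    by (intro compact_continuous_image continuous_on_norm continuous_on_subset[OF assms]) auto
  then have "bdd_above ((\<lambda>z. cmod (f z)) ` sphere 0 (cmod z))"
    by (intro bounded_imp_bdd_above compact_imp_bounded)
  then show ?thesis
    unfolding max_modulus_def by (rule cSUP_upper[rotated]) simp
qed

lemma min_modulus_le_cmod:
  "min_modulus (cmod z) f \<le> cmod (f z)"
  unfolding min_modulus_def by (rule cINF_lower) (auto intro: bdd_belowI[of _ 0])

lemma max_modulus_attained:
  assumes "continuous_on UNIV f" "0 \<le> r"
  obtains z where "cmod z = r" "cmod (f z) = max_modulus r f"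
proof -
  have "sphere (0::complex) r \<noteq> {}"
    using assms(2) by simp
  moreover have "continuous_on (sphere 0 r) (\<lambda>z. cmod (f z))"
    by (intro continuous_on_norm continuous_on_subset[OF assms(1)]) auto
  ultimately obtain z where z: "z \<in> sphere 0 r" "\<And>y. y \<in> sphere 0 r \<Longrightarrow> cmod (f y) \<le> cmod (f z)"
    using continuous_attains_sup[OF compact_sphere] by blast
  have "max_modulus r f = cmod (f z)"
    unfolding max_modulus_def by (rule cSup_eq_maximum) (use z in auto)
  with z show thesis
    by (intro that[of z]) auto
qed

lemma min_modulus_attained:
  assumes "continuous_on UNIV f" "0 \<le> r"
  obtains z where "cmod z = r" "cmod (f z) = min_modulus r f"
proof -
  have "sphere (0::complex) r \<noteq> {}"
    using assms(2) by simp
  moreover have "continuous_on (sphere 0 r) (\<lambda>z. cmod (f z))"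
    by (intro continuous_on_norm continuous_on_subset[OF assms(1)]) auto
  ultimately obtain z where z: "z \<in> sphere 0 r" "\<And>y. y \<in> sphere 0 r \<Longrightarrow> cmod (f z) \<le> cmod (f y)"
    using continuous_attains_inf[OF compact_sphere] by blast
  have "min_modulus r f = cmod (f z)"
    unfolding min_modulus_def by (rule cInf_eq_minimum) (use z in auto)
  with z show thesis
    by (intro that[of z]) auto
qed

text \<open>\<open>max_modulus\<close> is a supremum over a circle; the maximum principle extends
  the bound to the enclosed disc.\<close>

lemma cmod_le_max_modulus:
  assumes "f holomorphic_on UNIV" "cmod z \<le> r"
  shows "cmod (f z) \<le> max_modulus r f"
proof (rule maximum_modulus_frontier[where S = "cball 0 r" and f = f])
  have cont: "continuous_on UNIV f"
    using assms(1) by (rule holomorphic_on_imp_continuous_on)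
  show "f holomorphic_on interior (cball 0 r)"
    using assms(1) by (rule holomorphic_on_subset) simp
  show "continuous_on (closure (cball 0 r)) f"
    using cont by (rule continuous_on_subset) simp
  show "cmod (f w) \<le> max_modulus r f" if "w \<in> frontier (cball 0 r)" for w
  proof -
    have "cmod w = r"
      using that by (cases "r = 0") (auto simp: frontier_def)
    then show ?thesis
      using cmod_le_max_modulus_sphere[OF cont, of w] by simp
  qed
qed (use assms in auto)

lemma max_modulus_mono:
  assumes "f holomorphic_on UNIV" "0 \<le> r" "r \<le> s"
  shows "max_modulus r f \<le> max_modulus s f"
proof -
  obtain z where "cmod z = r" "cmod (f z) = max_modulus r f"
    using max_modulus_attained holomorphic_on_imp_continuous_on assms by metis
  then show ?thesis
    using cmod_le_max_modulus[OF assms(1), of z s] assms by simp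
qed

text \<open>Constants are polynomials, so Liouville's theorem makes \<open>f\<close> unbounded; the
  maximum principle passes a large value on to all larger radii.\<close>

lemma eventually_max_modulus_gt:
  assumes "transcendental_entire f"
  shows "\<forall>\<^sub>F r in at_top. B < max_modulus r f"
proof -
  have holo: "f holomorphic_on UNIV"
    using assms by (simp add: transcendental_entire_def)
  have "\<not> f constant_on UNIV"
  proof
    assume "f constant_on UNIV"
    then obtain c where "\<And>z. f z = c"
      unfolding constant_on_def by blast
    then have "\<forall>z. f z = poly [:c:] z"
      by simp
    then show False
      using assms unfolding transcendental_entire_def by blast
  qed
  then have "\<not> bounded (range f)"
    using Liouville_theorem[OF holo] by blast
  then obtain z where z: "B < cmod (f z)"
    unfolding bounded_iff by (auto simp: not_le)
  show ?thesis
    using eventually_ge_at_top[of "cmod z"]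
    by eventually_elim (use z cmod_le_max_modulus[OF holo] less_le_trans in blast)
qed

section \<open>Borel measurability and use of the exceptional radii\<close>

text \<open>Closed sets in the plane are countable unions of compact sets, whose images under the
  norm are compact.\<close>

lemma borel_norm_image_closed:
  fixes S :: "complex set"
  assumes "closed S"
  shows "norm ` S \<in> sets borel"
proof -
  have "norm ` S = (\<Union>n::nat. norm ` (S \<inter> cball 0 (real n)))"
    using real_arch_simple by fastforce
  moreover have "closed (norm ` (S \<inter> cball 0 (real n)))" for n
    using closed_Int_compact[OF assms compact_cball]
    by (intro compact_imp_closed compact_continuous_image continuous_intros)
  ultimately show ?thesis
    by (metis (no_types, lifting) borel_closed sets.countable_UN rangeE image_subset_iff)
qed

text \<open>Since the maximum is attained, a superlevel set consists of the \<open>r\<close> for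
  which \<bar>r\<bar> is the norm of a point of a closed set. The absolute value avoids the empty
  circles of negative radius.\<close>

lemma borel_measurable_max_modulus:
  assumes "continuous_on UNIV f"
  shows "(\<lambda>r. max_modulus \<bar>r\<bar> f) \<in> borel_measurable borel"
  unfolding borel_measurable_iff_ge
proof
  fix a
  have "closed {z. a \<le> cmod (f z)}"
    using assms by (intro closed_Collect_le continuous_intros) auto
  then have "norm ` {z. a \<le> cmod (f z)} \<in> sets borel"
    by (rule borel_norm_image_closed)
  then have "abs -` (norm ` {z. a \<le> cmod (f z)}) \<inter> space borel \<in> sets (borel :: real measure)"
    by (rule measurable_sets[rotated]) measurable
  moreover have "{r \<in> space borel. a \<le> max_modulus \<bar>r\<bar> f} =
      abs -` (norm ` {z. a \<le> cmod (f z)}) \<inter> space borel"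
  proof (intro set_eqI iffI; clarsimp)
    fix r assume "a \<le> max_modulus \<bar>r\<bar> f"
    moreover obtain z where "cmod z = \<bar>r\<bar>" "cmod (f z) = max_modulus \<bar>r\<bar> f"
      using max_modulus_attained[OF assms abs_ge_zero] by blast
    ultimately show "\<bar>r\<bar> \<in> norm ` {z. a \<le> cmod (f z)}"
      by (intro image_eqI[of _ _ z]) auto
  next
    fix r z assume "\<bar>r\<bar> = cmod z" "a \<le> cmod (f z)"
    then show "a \<le> max_modulus (cmod z) f"
      using cmod_le_max_modulus_sphere[OF assms, of z] by simp
  qed
  ultimately show "{r \<in> space borel. a \<le> max_modulus \<bar>r\<bar> f} \<in> sets borel"
    by simp
qed

lemma borel_measurable_min_modulus:
  assumes "continuous_on UNIV f"
  shows "(\<lambda>r. min_modulus \<bar>r\<bar> f) \<in> borel_measurable borel"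
  unfolding borel_measurable_iff_le
proof
  fix a
  have "closed {z. cmod (f z) \<le> a}"
    using assms by (intro closed_Collect_le continuous_intros) auto
  then have "norm ` {z. cmod (f z) \<le> a} \<in> sets borel"
    by (rule borel_norm_image_closed)
  then have "abs -` (norm ` {z. cmod (f z) \<le> a}) \<inter> space borel \<in> sets (borel :: real measure)"
    by (rule measurable_sets[rotated]) measurable
  moreover have "{r \<in> space borel. min_modulus \<bar>r\<bar> f \<le> a} =
      abs -` (norm ` {z. cmod (f z) \<le> a}) \<inter> space borel"
  proof (intro set_eqI iffI; clarsimp)
    fix r assume "min_modulus \<bar>r\<bar> f \<le> a"
    moreover obtain z where "cmod z = \<bar>r\<bar>" "cmod (f z) = min_modulus \<bar>r\<bar> f"
      using min_modulus_attained[OF assms abs_ge_zero] by blast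
    ultimately show "\<bar>r\<bar> \<in> norm ` {z. cmod (f z) \<le> a}"
      by (intro image_eqI[of _ _ z]) auto
  next
    fix r z assume "\<bar>r\<bar> = cmod z" "cmod (f z) \<le> a"
    then show "min_modulus (cmod z) f \<le> a"
      using min_modulus_le_cmod[of z f] by simp
  qed
  ultimately show "{r \<in> space borel. min_modulus \<bar>r\<bar> f \<le> a} \<in> sets borel"
    by simp
qed

text \<open>Measurability gives the density hypothesis its content: the integral of a non-integrable
  function is 0 by default.\<close>

lemma borel_exceptional_radii:
  assumes "continuous_on UNIV f"
  shows "exceptional_radii f \<epsilon> \<in> sets borel"
proof -
  have [measurable]: "ext_ln \<in> borel_measurable borel"
    unfolding ext_ln_def by measurable
  note [measurable] = borel_measurable_max_modulus[OF assms] borel_measurable_min_modulus[OF assms]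
  have "exceptional_radii f \<epsilon> = {r \<in> space borel. 1 < r \<and>
      ext_ln (min_modulus \<bar>r\<bar> f) \<le> ereal \<epsilon> * ext_ln (max_modulus \<bar>r\<bar> f)}"
    unfolding exceptional_radii_def by auto
  also have "\<dots> \<in> sets borel"
    by measurable
  finally show ?thesis .
qed

text \<open>Returns from \<open>ext_ln\<close> to the real logarithm: the bound from below is
  finite, which excludes the value -\<infinity> and hence a zero of \<open>f\<close> on the
  circle.\<close>

lemma ln_min_modulus_gt:
  assumes "1 < r" "r \<notin> exceptional_radii f \<epsilon>" "0 < max_modulus r f"
  shows "0 < min_modulus r f" "\<epsilon> * ln (max_modulus r f) < ln (min_modulus r f)"
proof -
  have *: "ereal (\<epsilon> * ln (max_modulus r f)) < ext_ln (min_modulus r f)"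
    using assms by (simp add: exceptional_radii_def ext_ln_def not_le)
  then show "0 < min_modulus r f"
    by (auto simp: ext_ln_def split: if_splits)
  with * show "\<epsilon> * ln (max_modulus r f) < ln (min_modulus r f)"
    by (simp add: ext_ln_def)
qed

section \<open>Logarithmic density\<close>

lemma lebesgue_set_integral_inverse_ge:
  fixes E :: "real set"
  assumes E: "E \<in> sets borel" and ab: "1 \<le> a" "a \<le> b" and sub: "{a<..<b} \<subseteq> E"
  shows "ln b - ln a \<le> (LINT t : E \<inter> {1<..<b} | lebesgue. 1 / t)"
proof -
  \<comment> \<open>Integrability on \<open>{1..b}\<close> passes to both subsets, so neither
    integral takes its default value 0.\<close>
  have int: "set_integrable lebesgue {1..b} (\<lambda>t. 1 / t)"
    by (intro absolutely_integrable_continuous_real continuous_intros) auto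
  have int_E: "set_integrable lebesgue (E \<inter> {1<..<b}) (\<lambda>t. 1 / t)"
    by (rule set_integrable_subset[OF int]) (use E in \<open>auto intro!: sets_completionI_sets\<close>)
  have int_ab: "set_integrable lebesgue {a<..<b} (\<lambda>t. 1 / t)"
    by (rule set_integrable_subset[OF int]) (use ab in auto)
  have "((\<lambda>t. 1 / t) has_integral ln b - ln a) {a..b}"
    using ab by (intro fundamental_theorem_of_calculus)
      (auto intro!: derivative_eq_intros simp flip: has_real_derivative_iff_has_vector_derivative)
  then have "integral {a<..<b} (\<lambda>t. 1 / t) = ln b - ln a"
    by (simp add: has_integral_Icc_iff_Ioo integral_unique)
  then have "ln b - ln a = integral {a<..<b} (\<lambda>t. 1 / t)" by simp
  also have "\<dots> \<le> integral (E \<inter> {1<..<b}) (\<lambda>t. 1 / t)"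
    by (rule integral_subset_le)
       (use sub ab set_lebesgue_integral_eq_integral(1)[OF int_ab]
          set_lebesgue_integral_eq_integral(1)[OF int_E] in auto)
  also have "\<dots> = (LINT t : E \<inter> {1<..<b} | lebesgue. 1 / t)"
    using set_lebesgue_integral_eq_integral(2)[OF int_E] by simp
  finally show ?thesis .
qed

text \<open>If \<open>E\<close> contained the whole interval from \<open>r\<^sup>2\<close> to
  \<open>r powr S\<close>, the density quotient at \<open>R = r powr S\<close> would be at least (S
  - 2) / S, which exceeds \<open>\<epsilon>\<close> for large \<open>S\<close>.\<close>

lemma upper_log_dens_gap:
  assumes E: "E \<in> sets borel" and dens: "upper_log_dens E \<le> ereal \<epsilon>" and \<epsilon>: "0 < \<epsilon>" "\<epsilon> < 1"
  obtains S where "S > 2" "\<forall>\<^sub>F r in at_top. \<exists>t. r\<^sup>2 < t \<and> t < r powr S \<and> t \<notin> E"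
proof -
  \<comment> \<open>Any number strictly between \<open>\<epsilon>\<close> and 1 would do;
    \<open>S\<close> then solves (S - 2) / S = d.\<close>
  define d where "d = (1 + \<epsilon>) / 2"
  have d: "\<epsilon> < d" "0 < d" "d < 1"
    using \<epsilon> by (auto simp: d_def)
  define S where "S = 2 / (1 - d)"
  have S: "S > 2" "(S - 2) / S = d"
    using d by (auto simp: S_def field_simps)
  have "upper_log_dens E < ereal d"
    using dens d(1) by (meson ereal_less_eq(3) le_less_trans less_ereal.simps(1))
  then have "\<forall>\<^sub>F R in at_top. ereal (1 / ln R * (LINT t : E \<inter> {1<..<R} | lebesgue. 1 / t)) < ereal d"
    unfolding upper_log_dens_def by (rule Limsup_lessD)
  moreover have "filterlim (\<lambda>r::real. r powr S) at_top at_top"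
  proof (rule filterlim_at_top_mono[OF filterlim_ident])
    show "\<forall>\<^sub>F r::real in at_top. r \<le> r powr S"
      using eventually_ge_at_top[of 1]
    proof eventually_elim
      case (elim r)
      then show ?case
        using powr_mono[of 1 S r] S by simp
    qed
  qed
  ultimately have "\<forall>\<^sub>F r in at_top.
      ereal (1 / ln (r powr S) * (LINT t : E \<inter> {1<..<r powr S} | lebesgue. 1 / t)) < ereal d"
    unfolding filterlim_iff by blast
  with eventually_gt_at_top[of 1]
  have "\<forall>\<^sub>F r in at_top. \<exists>t. r\<^sup>2 < t \<and> t < r powr S \<and> t \<notin> E"
  proof eventually_elim
    case (elim r)
    show ?case
    proof (rule ccontr)
      assume "\<not> ?case"
      then have sub: "{r\<^sup>2<..<r powr S} \<subseteq> E"
        by auto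
      have r: "1 \<le> r\<^sup>2" "r\<^sup>2 \<le> r powr S"
        using elim(1) S(1) powr_mono[of 2 S r] by auto
      have "ln (r powr S) - ln (r\<^sup>2) = (S - 2) * ln r"
        using elim(1) by (simp add: ln_powr ln_realpow algebra_simps)
      then have "(S - 2) * ln r \<le> (LINT t : E \<inter> {1<..<r powr S} | lebesgue. 1 / t)"
        using lebesgue_set_integral_inverse_ge[OF E r sub] by simp
      also have "\<dots> < d * ln (r powr S)"
        using elim S(1) by (simp add: ln_powr field_simps)
      also have "\<dots> = (S - 2) * ln r"
        using elim(1) S by (simp add: ln_powr flip: S(2))
      finally show False
        by simp
    qed
  qed
  with S(1) show thesis
    by (rule that)
qed

section \<open>Consequences of the growth condition, with \<open>h r\<close> standing for log M(r,
  f)\<close>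

lemma growth_iterate:
  fixes h :: "real \<Rightarrow> real"
  assumes C: "1 < C\<^sub>1" "1 < C\<^sub>2" and R: "0 < R"
    and grow: "\<And>r. R \<le> r \<Longrightarrow> C\<^sub>2 * h r \<le> h (C\<^sub>1 * r)" and r: "R \<le> r"
  shows "C\<^sub>2 ^ k * h r \<le> h (C\<^sub>1 ^ k * r)"
proof (induction k)
  case (Suc k)
  have "1 * r \<le> C\<^sub>1 ^ k * r"
    using C R r by (intro mult_right_mono one_le_power) auto
  then have "C\<^sub>2 * h (C\<^sub>1 ^ k * r) \<le> h (C\<^sub>1 * (C\<^sub>1 ^ k * r))"
    using r by (intro grow) simp
  moreover have "C\<^sub>2 * (C\<^sub>2 ^ k * h r) \<le> C\<^sub>2 * h (C\<^sub>1 ^ k * r)"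
    using Suc C by (intro mult_left_mono) auto
  ultimately show ?case
    by (simp add: mult.assoc)
qed simp

text \<open>Once \<open>r\<close> is at least \<open>C\<^sub>1 ^ k\<close>, the step from
  \<open>r\<close> to \<open>r\<^sup>2\<close> covers \<open>k\<close> multiplications by
  \<open>C\<^sub>1\<close>, and each of them gains a factor \<open>C\<^sub>2\<close>.\<close>

lemma growth_square:
  fixes h :: "real \<Rightarrow> real"
  assumes C: "1 < C\<^sub>1" "1 < C\<^sub>2" and R: "0 < R"
    and grow: "\<And>r. R \<le> r \<Longrightarrow> C\<^sub>2 * h r \<le> h (C\<^sub>1 * r)"
    and mono: "\<And>r s. 0 \<le> r \<Longrightarrow> r \<le> s \<Longrightarrow> R \<le> r \<Longrightarrow> h r \<le> h s"
    and pos: "\<And>r. R \<le> r \<Longrightarrow> 0 < h r"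
  shows "\<forall>\<^sub>F r in at_top. L * h r \<le> h (r\<^sup>2)"
proof -
  obtain k where k: "L < C\<^sub>2 ^ k"
    using real_arch_pow C(2) by blast
  show ?thesis
    using eventually_ge_at_top[of R] eventually_ge_at_top[of "C\<^sub>1 ^ k"]
  proof eventually_elim
    case (elim r)
    have "L * h r \<le> C\<^sub>2 ^ k * h r"
      using k pos[OF elim(1)] by (intro mult_right_mono) auto
    also have "\<dots> \<le> h (C\<^sub>1 ^ k * r)"
      by (rule growth_iterate[where h = h, OF C R grow elim(1)])
    also have "\<dots> \<le> h (r\<^sup>2)"
    proof (rule mono)
      have "1 * r \<le> C\<^sub>1 ^ k * r"
        using C R elim(1) by (intro mult_right_mono one_le_power) auto
      then show "R \<le> C\<^sub>1 ^ k * r" "0 \<le> C\<^sub>1 ^ k * r"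
        using elim(1) R by linarith+
      show "C\<^sub>1 ^ k * r \<le> r\<^sup>2"
        unfolding power2_eq_square using elim R by (intro mult_right_mono) auto
    qed
    finally show ?case .
  qed
qed

text \<open>Along the radii \<open>C\<^sub>1 ^ k * R\<close> the function \<open>h\<close> grows
  exponentially in \<open>k\<close>, the logarithm only linearly. Exponentiated, this yields 2r
  \<le> M(r, f).\<close>

lemma growth_ge_ln:
  fixes h :: "real \<Rightarrow> real"
  assumes C: "1 < C\<^sub>1" "1 < C\<^sub>2" and R: "0 < R"
    and grow: "\<And>r. R \<le> r \<Longrightarrow> C\<^sub>2 * h r \<le> h (C\<^sub>1 * r)"
    and mono: "\<And>r s. 0 \<le> r \<Longrightarrow> r \<le> s \<Longrightarrow> R \<le> r \<Longrightarrow> h r \<le> h s"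
    and pos: "\<And>r. R \<le> r \<Longrightarrow> 0 < h r"
  shows "\<forall>\<^sub>F r in at_top. ln (2 * r) \<le> h r"
proof -
  have h: "0 < h R"
    by (rule pos) simp
  have "(\<lambda>k. real k / C\<^sub>2 ^ k) \<longlonglongrightarrow> 0"
    using lim_n_over_pown[of C\<^sub>2] C(2) by simp
  moreover have "(\<lambda>k. inverse (C\<^sub>2 ^ k)) \<longlonglongrightarrow> 0"
    using LIMSEQ_inverse_realpow_zero[OF C(2)] .
  \<comment> \<open>The expression is \<open>ln (2 * (C\<^sub>1 ^ Suc k * R))\<close> divided by
    \<open>C\<^sub>2 ^ k\<close>.\<close>
  ultimately have "(\<lambda>k. (ln (2 * R) + ln C\<^sub>1) * inverse (C\<^sub>2 ^ k) + real k / C\<^sub>2 ^ k * ln C\<^sub>1)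
      \<longlonglongrightarrow> (ln (2 * R) + ln C\<^sub>1) * 0 + 0 * ln C\<^sub>1"
    by (intro tendsto_intros)
  then have "\<forall>\<^sub>F k in sequentially.
      (ln (2 * R) + ln C\<^sub>1) * inverse (C\<^sub>2 ^ k) + real k / C\<^sub>2 ^ k * ln C\<^sub>1 < h R"
    using h by (intro order_tendstoD) auto
  then obtain K where K: "\<And>k. K \<le> k \<Longrightarrow>
      (ln (2 * R) + ln C\<^sub>1) * inverse (C\<^sub>2 ^ k) + real k / C\<^sub>2 ^ k * ln C\<^sub>1 < h R"
    unfolding eventually_sequentially by blast
  show ?thesis
    using eventually_ge_at_top[of R] eventually_ge_at_top[of "C\<^sub>1 ^ K * R"]
  proof eventually_elim
    case (elim r)
    \<comment> \<open>With \<open>n = Suc k\<close> this places \<open>r\<close> between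
      \<open>C\<^sub>1 ^ k * R\<close> and \<open>C\<^sub>1 ^ Suc k * R\<close>; the lower bound on
      \<open>r\<close> forces \<open>k\<close> to be at least \<open>K\<close>.\<close>
    define n where "n = (LEAST n. r / R < C\<^sub>1 ^ n)"
    have n: "r / R < C\<^sub>1 ^ n"
      unfolding n_def by (rule LeastI_ex) (use real_arch_pow[OF C(1)] in blast)
    have "C\<^sub>1 ^ K < C\<^sub>1 ^ n"
      using elim(2) R by (intro le_less_trans[OF _ n]) (simp add: field_simps)
    then have "K < n"
      using C(1) by simp
    then obtain k where k: "n = Suc k" "K \<le> k"
      by (cases n) auto
    have "\<not> r / R < C\<^sub>1 ^ k"
      using not_less_Least[of k "\<lambda>n. r / R < C\<^sub>1 ^ n"] k by (simp add: n_def)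
    then have lo: "C\<^sub>1 ^ k * R \<le> r"
      using R by (simp add: field_simps)
    have hi: "r < C\<^sub>1 ^ Suc k * R"
      using n R k by (simp add: field_simps)
    have "2 * r \<le> 2 * (C\<^sub>1 ^ Suc k * R)"
      using hi by simp
    then have "ln (2 * r) \<le> ln (2 * (C\<^sub>1 ^ Suc k * R))"
      using elim(1) R by (subst ln_le_cancel_iff) auto
    also have "\<dots> = ln (2 * R) + ln C\<^sub>1 + real k * ln C\<^sub>1"
      using R C by (simp add: ln_mult ln_realpow algebra_simps)
    also have "\<dots> = C\<^sub>2 ^ k * ((ln (2 * R) + ln C\<^sub>1) * inverse (C\<^sub>2 ^ k) + real k / C\<^sub>2 ^ k * ln C\<^sub>1)"
      using C by (simp add: field_simps)
    also have "\<dots> \<le> C\<^sub>2 ^ k * h R"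
      using K[OF k(2)] C by (intro mult_left_mono) auto
    also have "\<dots> \<le> h (C\<^sub>1 ^ k * R)"
      by (rule growth_iterate[where h = h, OF C R grow order_refl])
    also have "\<dots> \<le> h r"
    proof (rule mono[OF _ lo])
      have "1 * R \<le> C\<^sub>1 ^ k * R"
        using C R by (intro mult_right_mono one_le_power) auto
      then show "R \<le> C\<^sub>1 ^ k * R" "0 \<le> C\<^sub>1 ^ k * R"
        using R by linarith+
    qed
    finally show ?case .
  qed
qed

section \<open>Bounded components\<close>

text \<open>\<open>R\<close> and \<open>S\<close> are the same for all components, which is what
  makes the final bound uniform. \<open>M_sq\<close> keeps the induction along the orbit going;
  \<open>M_sq_lim\<close>, with its arbitrary factor, defeats the Harnack constant.\<close>

lemma fatou_component_spread:
  assumes holo: "f holomorphic_on UNIV" and R: "2 \<le> R" and S: "2 < S" and \<epsilon>: "0 < \<epsilon>"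
    and gap: "\<And>r. R \<le> r \<Longrightarrow> \<exists>t. r\<^sup>2 < t \<and> t < r powr S \<and> t \<notin> exceptional_radii f \<epsilon>"
    and M_gt1: "\<And>r. R \<le> r \<Longrightarrow> 1 < max_modulus r f"
    and M_ge: "\<And>r. R \<le> r \<Longrightarrow> 2 * r \<le> max_modulus r f"
    and M_sq: "\<And>r. R \<le> r \<Longrightarrow> S / \<epsilon> * ln (max_modulus r f) \<le> ln (max_modulus (r\<^sup>2) f)"
    and M_sq_lim: "\<And>L. \<forall>\<^sub>F r in at_top. L * ln (max_modulus r f) \<le> ln (max_modulus (r\<^sup>2) f)"
    and U: "U \<in> components (fatou_set f)" and ab: "a \<in> U" "b \<in> U"
  shows "cmod b < max (cmod a) R powr S"
proof (rule ccontr)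
  define r\<^sub>0 where "r\<^sub>0 = max (cmod a) R"
  assume "\<not> ?thesis"
  then have b: "r\<^sub>0 powr S \<le> cmod b"
    by (simp add: r\<^sub>0_def)
  define \<rho> where "\<rho> n = ((\<lambda>r. max_modulus r f) ^^ n) r\<^sub>0" for n
  have \<rho>_Suc: "\<rho> (Suc n) = max_modulus (\<rho> n) f" for n
    by (simp add: \<rho>_def)
  have \<rho>_bounds: "R \<le> \<rho> n \<and> real n \<le> \<rho> n" for n
  \<comment> \<open>Each step at least doubles a number that is at least 2, hence adds more than 1;
    so \<open>\<rho>\<close> tends to infinity.\<close>
  proof (induction n)
    case 0
    then show ?case
      using R by (simp add: \<rho>_def r\<^sub>0_def)
  next
    case (Suc n)
    then show ?case
      using M_ge[of "\<rho> n"] R unfolding \<rho>_Suc by auto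
  qed
  have \<rho>_ge: "R \<le> \<rho> n" for n
    using \<rho>_bounds by blast
  have \<rho>_gt1: "1 < \<rho> n" for n
    using \<rho>_ge[of n] R by linarith
  have \<rho>_lim: "filterlim \<rho> at_top sequentially"
    by (rule filterlim_at_top_mono[OF filterlim_real_sequentially]) (use \<rho>_bounds in simp)
  have orbit_a: "cmod ((f ^^ n) a) \<le> \<rho> n" for n
  proof (induction n)
    case 0
    then show ?case
      by (simp add: \<rho>_def r\<^sub>0_def)
  next
    case (Suc n)
    then show ?case
      using cmod_le_max_modulus[OF holo] by (simp add: \<rho>_Suc)
  qed
  have U': "open U" "connected U" "U \<subseteq> fatou_set f"
    using U open_components[OF open_fatou_set] in_components_connected[OF U]
      in_components_subset[OF U] by blast+
  then have "path_connected U"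
    using connected_open_path_connected by blast
  then obtain \<gamma> where \<gamma>: "path \<gamma>" "path_image \<gamma> \<subseteq> U" "pathstart \<gamma> = a" "pathfinish \<gamma> = b"
    unfolding path_connected_def using ab by blast
  define \<Gamma> where "\<Gamma> = path_image \<gamma>"
  have \<Gamma>: "compact \<Gamma>" "connected \<Gamma>" "\<Gamma> \<subseteq> U" "a \<in> \<Gamma>" "b \<in> \<Gamma>"
    using \<gamma> unfolding \<Gamma>_def
    by (auto simp: compact_path_image connected_path_image
        simp del: pathstart_in_path_image pathfinish_in_path_image
        intro: pathstart_in_path_image pathfinish_in_path_image)
  \<comment> \<open>On \<Gamma> the modulus of the iterate is small at \<open>a\<close> and large at
    \<open>v\<close>, so it takes the value \<open>t\<close> of a non-exceptional radius in between,
    where the minimum modulus bounds the next iterate from below.\<close>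
  have step: "\<exists>w\<in>\<Gamma>. \<epsilon> * ln (max_modulus ((\<rho> n)\<^sup>2) f) < ln (cmod ((f ^^ Suc n) w))"
    if v: "v \<in> \<Gamma>" "\<rho> n powr S \<le> cmod ((f ^^ n) v)" for n v
  proof -
    obtain t where t: "(\<rho> n)\<^sup>2 < t" "t < \<rho> n powr S" "t \<notin> exceptional_radii f \<epsilon>"
      using gap[OF \<rho>_ge] by blast
    have "1 * \<rho> n \<le> (\<rho> n)\<^sup>2"
      unfolding power2_eq_square using \<rho>_gt1[of n] by (intro mult_right_mono) auto
    with t(1) have \<rho>_t: "\<rho> n \<le> t" "\<rho> n \<le> (\<rho> n)\<^sup>2"
      by auto
    have "continuous_on \<Gamma> (\<lambda>z. cmod ((f ^^ n) z))"
      using holomorphic_on_imp_continuous_on[OF holomorphic_funpow[OF holo]]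
      by (intro continuous_on_norm) (rule continuous_on_subset, auto)
    then have conn: "connected ((\<lambda>z. cmod ((f ^^ n) z)) ` \<Gamma>)"
      using \<Gamma>(2) by (rule connected_continuous_image)
    have "t \<in> (\<lambda>z. cmod ((f ^^ n) z)) ` \<Gamma>"
    proof (rule connectedD_interval[OF conn])
      show "cmod ((f ^^ n) a) \<le> t" "t \<le> cmod ((f ^^ n) v)"
        using orbit_a[of n] \<rho>_t v t by linarith+
    qed (use \<Gamma> v in auto)
    then obtain w where w: "w \<in> \<Gamma>" "cmod ((f ^^ n) w) = t"
      by blast
    have t1: "1 < t" and R_t: "R \<le> (\<rho> n)\<^sup>2"
      using \<rho>_t \<rho>_gt1[of n] \<rho>_ge[of n] by linarith+
    have le_t: "max_modulus ((\<rho> n)\<^sup>2) f \<le> max_modulus t f"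
      using t by (intro max_modulus_mono[OF holo]) auto
    then have M_t: "0 < max_modulus t f"
      using M_gt1[OF R_t] by simp
    have "\<epsilon> * ln (max_modulus ((\<rho> n)\<^sup>2) f) \<le> \<epsilon> * ln (max_modulus t f)"
      using le_t M_gt1[OF R_t] \<epsilon> by (intro mult_left_mono ln_mono) auto
    also have "\<epsilon> * ln (max_modulus t f) < ln (min_modulus t f)"
      using ln_min_modulus_gt[OF t1 t(3) M_t] by simp
    also have "\<dots> \<le> ln (cmod (f ((f ^^ n) w)))"
    proof (rule ln_mono)
      show m: "0 < min_modulus t f"
        using ln_min_modulus_gt[OF t1 t(3) M_t] by simp
      show le: "min_modulus t f \<le> cmod (f ((f ^^ n) w))"
        using min_modulus_le_cmod[of "(f ^^ n) w" f] w by simp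
    qed
    finally show ?thesis
      using w(1) by auto
  qed
  \<comment> \<open>The factor \<open>S / \<epsilon>\<close> in \<open>M_sq\<close> absorbs the loss
    of \<open>\<epsilon>\<close> and restores the induction hypothesis with the same
    \<open>S\<close>.\<close>
  have step_S: "\<rho> (Suc n) powr S \<le> cmod ((f ^^ Suc n) w)"
    if "\<epsilon> * ln (max_modulus ((\<rho> n)\<^sup>2) f) < ln (cmod ((f ^^ Suc n) w))" for n w
  proof -
    have "S * ln (\<rho> (Suc n)) = \<epsilon> * (S / \<epsilon> * ln (\<rho> (Suc n)))"
      using \<epsilon> by simp
    also have "\<dots> \<le> \<epsilon> * ln (max_modulus ((\<rho> n)\<^sup>2) f)"
      using M_sq[OF \<rho>_ge, of n] \<epsilon> by (intro mult_left_mono) (auto simp: \<rho>_Suc)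
    finally have le: "S * ln (\<rho> (Suc n)) < ln (cmod ((f ^^ Suc n) w))"
      using that by simp
    moreover have pos: "0 < S * ln (\<rho> (Suc n))"
      using S ln_gt_zero[OF \<rho>_gt1[of "Suc n"]] by simp
    \<comment> \<open>Here \<open>ln 0 = 0\<close>, so a positive logarithm excludes the value
      0.\<close>
    ultimately have "cmod ((f ^^ Suc n) w) \<noteq> 0"
      by auto
    then have "0 < cmod ((f ^^ Suc n) w)"
      by simp
    moreover have "\<rho> (Suc n) powr S = exp (S * ln (\<rho> (Suc n)))"
      using \<rho>_gt1[of "Suc n"] by (simp add: powr_def)
    ultimately show ?thesis
      using le by (metis exp_le_cancel_iff exp_ln less_imp_le)
  qed
  have "\<exists>v\<in>\<Gamma>. \<rho> n powr S \<le> cmod ((f ^^ n) v)" for n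
  proof (induction n)
    case 0
    then show ?case
      using b \<Gamma>(5) by (auto simp: \<rho>_def)
  next
    case (Suc n)
    then show ?case
      using step step_S by metis
  qed
  then have "\<forall>n. \<exists>w\<in>\<Gamma>. \<epsilon> * ln (max_modulus ((\<rho> n)\<^sup>2) f) < ln (cmod ((f ^^ Suc n) w))"
    using step by blast
  then obtain w where w: "\<And>n. w n \<in> \<Gamma>"
    "\<And>n. \<epsilon> * ln (max_modulus ((\<rho> n)\<^sup>2) f) < ln (cmod ((f ^^ Suc n) (w n)))"
    by metis
  have w_esc: "filterlim (\<lambda>n. cmod ((f ^^ Suc n) (w n))) at_top sequentially"
  proof (rule filterlim_at_top_mono)
    show "filterlim (\<lambda>n. \<rho> (Suc n)) at_top sequentially"
      using filterlim_compose[OF \<rho>_lim filterlim_Suc] .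
    have "\<rho> (Suc n) \<le> cmod ((f ^^ Suc n) (w n))" for n
      using step_S[OF w(2)[of n]] powr_mono[of 1 S "\<rho> (Suc n)"] S \<rho>_gt1[of "Suc n"] by simp
    then show "\<forall>\<^sub>F n in sequentially. \<rho> (Suc n) \<le> cmod ((f ^^ Suc n) (w n))"
      by simp
  qed
  \<comment> \<open>The points \<open>w n\<close> move with \<open>n\<close>; a limit point on the
    compact path provides one fixed disc containing infinitely many of them.\<close>
  obtain w' s where w': "w' \<in> \<Gamma>" and s: "strict_mono (s :: nat \<Rightarrow> nat)" "(w \<circ> s) \<longlonglongrightarrow> w'"
    using \<Gamma>(1) w(1) unfolding compact_def by metis
  have w'_U: "w' \<in> U" "w' \<in> fatou_set f"
    using w' \<Gamma>(3) U'(3) by auto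
  from fatou_escape_local[OF holo w'_U(2)] obtain \<delta> where \<delta>: "\<delta> > 0" and
    loc: "\<And>r x. (\<And>k. r k \<ge> 1) \<Longrightarrow> (\<And>k. x k \<in> ball w' \<delta>) \<Longrightarrow>
       filterlim (\<lambda>k. cmod ((f ^^ r k) (x k))) at_top sequentially \<Longrightarrow>
       (\<forall>B. \<forall>\<^sub>F k in sequentially. \<forall>w\<in>ball w' \<delta>. B < cmod ((f ^^ r k) w)) \<and>
       (\<forall>\<^sub>F k in sequentially. \<forall>w\<in>ball w' \<delta>. \<forall>w''\<in>ball w' \<delta>.
          ln (cmod ((f ^^ r k) w)) \<le> 3 * ln (cmod ((f ^^ r k) w'')))"
    by blast
  have "\<forall>\<^sub>F k in sequentially. dist ((w \<circ> s) k) w' < \<delta>"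
    using tendstoD[OF s(2) \<delta>] .
  then obtain k\<^sub>0 where k\<^sub>0: "\<And>k. k\<^sub>0 \<le> k \<Longrightarrow> dist ((w \<circ> s) k) w' < \<delta>"
    unfolding eventually_sequentially by blast
  \<comment> \<open>The shift by \<open>k\<^sub>0\<close> puts every point of the subsequence in the
    disc, as \<open>loc\<close> demands for all \<open>k\<close>.\<close>
  define u where "u k = s (k + k\<^sub>0)" for k
  have u: "filterlim u sequentially sequentially"
    unfolding u_def using s(1)
    by (intro filterlim_subseq) (auto simp: strict_mono_def)
  have w_ball: "w (u k) \<in> ball w' \<delta>" for k
    using k\<^sub>0[of "k + k\<^sub>0"] by (simp add: u_def dist_commute)
  have "filterlim (\<lambda>k. cmod ((f ^^ Suc (u k)) (w (u k)))) at_top sequentially"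
    using filterlim_compose[OF w_esc u] .
  from loc[of "\<lambda>k. Suc (u k)" "\<lambda>k. w (u k)", OF _ w_ball this]
  have loc1: "\<And>B. \<forall>\<^sub>F k in sequentially. \<forall>w\<in>ball w' \<delta>. B < cmod ((f ^^ Suc (u k)) w)"
    and loc2: "\<forall>\<^sub>F k in sequentially. \<forall>w\<in>ball w' \<delta>. \<forall>w''\<in>ball w' \<delta>.
          ln (cmod ((f ^^ Suc (u k)) w)) \<le> 3 * ln (cmod ((f ^^ Suc (u k)) w''))"
    by auto
  have "\<forall>\<^sub>F k in sequentially. B < cmod ((f ^^ Suc (u k)) w')" for B
    using loc1[of B] by eventually_elim (use \<delta> in simp)
  then have "filterlim (\<lambda>k. cmod ((f ^^ Suc (u k)) w')) at_top sequentially"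
    unfolding filterlim_at_top_dense by blast
  from fatou_escape_comparable[where r = "\<lambda>k. Suc (u k)", OF holo U' ab(1) w'_U(1) _ this]
  obtain K where K: "K > 0" "filterlim (\<lambda>k. cmod ((f ^^ Suc (u k)) a)) at_top sequentially"
    "\<forall>\<^sub>F k in sequentially. ln (cmod ((f ^^ Suc (u k)) w')) \<le> K * ln (cmod ((f ^^ Suc (u k)) a))"
    by auto
  have "\<forall>\<^sub>F k in sequentially. 0 < cmod ((f ^^ Suc (u k)) a)"
    using K(2) unfolding filterlim_at_top_dense by blast
  \<comment> \<open>The total Harnack constant is \<open>3 * K\<close>: a factor 3 from
    \<open>w (u k)\<close> to \<open>w'\<close> and \<open>K\<close> from \<open>w'\<close> to
    \<open>a\<close>. The additional 1 produces the contradiction.\<close>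
  moreover have "\<forall>\<^sub>F k in sequentially.
      (3 * K + 1) / \<epsilon> * ln (max_modulus (\<rho> (u k)) f) \<le> ln (max_modulus ((\<rho> (u k))\<^sup>2) f)"
    using M_sq_lim filterlim_compose[OF \<rho>_lim u] unfolding filterlim_iff by blast
  ultimately have "\<forall>\<^sub>F k in sequentially. False"
    using loc2 K(3)
  proof eventually_elim
    case (elim k)
    let ?M = "max_modulus (\<rho> (u k)) f"
    have "(3 * K + 1) * ln ?M = \<epsilon> * ((3 * K + 1) / \<epsilon> * ln ?M)"
      using \<epsilon> by simp
    also have "\<dots> \<le> \<epsilon> * ln (max_modulus ((\<rho> (u k))\<^sup>2) f)"
      using elim(2) \<epsilon> by (intro mult_left_mono) auto
    also have "\<dots> < ln (cmod ((f ^^ Suc (u k)) (w (u k))))"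
      by (rule w(2))
    also have "\<dots> \<le> 3 * ln (cmod ((f ^^ Suc (u k)) w'))"
      using elim(3) w_ball[of k] \<delta> by simp
    also have "\<dots> \<le> 3 * (K * ln (cmod ((f ^^ Suc (u k)) a)))"
      using elim(4) by simp
    also have "\<dots> \<le> 3 * (K * ln ?M)"
      using ln_mono[OF orbit_a elim(1)] K(1) by (simp add: \<rho>_Suc)
    finally have "ln ?M < 0"
      by (simp add: algebra_simps)
    then show False
      using ln_gt_zero[OF M_gt1[OF \<rho>_ge[of "u k"]]] by simp
  qed
  then show False
    by simp
qed

text \<open>Reduces the bound to pairs of points with one common constant. The infimum is a real
  number that is at least 1, because 3 exceeds e, so the extended quotient is an ordinary
  division.\<close>

lemma B1_finiteI:
  assumes "\<And>U z w. U \<in> components (fatou_set f) \<Longrightarrow> z \<in> U \<Longrightarrow> w \<in> U \<Longrightarrow>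
      ln (cmod z + 3) \<le> C * ln (cmod w + 3)"
  shows "B1 f < \<infinity>"
proof -
  have "(SUP z\<in>U. ereal (ln (cmod z + 3))) / (INF w\<in>U. ereal (ln (cmod w + 3))) \<le> ereal C"
    if U: "U \<in> components (fatou_set f)" for U
  proof -
    obtain w where w: "w \<in> U"
      using in_components_nonempty[OF U] by blast
    define i where "i = (INF w\<in>U. ereal (ln (cmod w + 3)))"
    have ln3: "1 \<le> ln (cmod w + 3)" for w
      using ln3_gt_1 ln_mono[of 3 "cmod w + 3"] by simp
    have "ereal 1 \<le> i"
      unfolding i_def using ln3 by (intro INF_greatest) simp
    moreover have "i \<le> ereal (ln (cmod w + 3))"
      unfolding i_def using w by (rule INF_lower)
    ultimately obtain j where j: "i = ereal j" "1 \<le> j"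
      by (cases i) auto
    have C: "0 < C"
    proof (rule ccontr)
      assume "\<not> 0 < C"
      then have "C * ln (cmod w + 3) \<le> 0"
        using ln3[of w] by (intro mult_nonpos_nonneg) auto
      then show False
        using assms[OF U w w] ln3[of w] by linarith
    qed
    have "ereal (ln (cmod z + 3)) \<le> ereal (C * j)" if z: "z \<in> U" for z
    proof -
      have "ereal (ln (cmod z + 3) / C) \<le> i"
        unfolding i_def using assms[OF U z] C
        by (intro INF_greatest) (simp add: field_simps)
      then show ?thesis
        using C by (simp add: j field_simps)
    qed
    then have "(SUP z\<in>U. ereal (ln (cmod z + 3))) \<le> ereal (C * j)"
      by (rule SUP_least)
    then have "(SUP z\<in>U. ereal (ln (cmod z + 3))) / i \<le> ereal C"
      unfolding j using j(2) by (subst ereal_divide_le_pos) (auto simp: mult.commute)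
    then show ?thesis
      by (simp add: i_def)
  qed
  then have "B1 f \<le> ereal C"
    unfolding B1_def by (rule SUP_least)
  then show ?thesis
    by (rule le_less_trans) simp
qed

theorem theorem2:
  fixes f :: "complex \<Rightarrow> complex"
  assumes "transcendental_entire f"
    and "fatou_set f \<noteq> {}"
    and "f \<in> class_Delta"
    and "\<exists>M\<^sub>0 C\<^sub>1 C\<^sub>2 :: real. M\<^sub>0 > 0 \<and> C\<^sub>1 > 1 \<and> C\<^sub>2 > 1 \<and>
           {M\<^sub>0..} \<subseteq> {r. r > 0 \<and>
              ext_ln (max_modulus (C\<^sub>1 * r) f) \<ge> ereal C\<^sub>2 * ext_ln (max_modulus r f)}"
  shows "strongly_uniformly_bounded_fatou f"
proof -
  have holo: "f holomorphic_on UNIV"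
    using assms(1) by (simp add: transcendental_entire_def)
  obtain M\<^sub>0 C\<^sub>1 C\<^sub>2 where MC: "M\<^sub>0 > 0" "C\<^sub>1 > 1" "C\<^sub>2 > 1"
    and grow: "\<And>r. M\<^sub>0 \<le> r \<Longrightarrow>
      ext_ln (max_modulus (C\<^sub>1 * r) f) \<ge> ereal C\<^sub>2 * ext_ln (max_modulus r f)"
    using assms(4) by force
  obtain \<epsilon>\<^sub>1 \<epsilon> where \<epsilon>\<^sub>1: "0 < \<epsilon>\<^sub>1" "\<epsilon>\<^sub>1 < 1" and \<epsilon>: "0 < \<epsilon>"
    and dens: "upper_log_dens (exceptional_radii f \<epsilon>) \<le> ereal \<epsilon>\<^sub>1"
    using assms(3) unfolding class_Delta_def by blast
  obtain N where N: "\<And>r. N \<le> r \<Longrightarrow> 1 < max_modulus r f"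
    using eventually_max_modulus_gt[OF assms(1), of 1] unfolding eventually_at_top_linorder by blast
  \<comment> \<open>From here on M(r, f) exceeds 1, so \<open>ext_ln\<close> agrees with
    \<open>ln\<close> and the growth condition becomes one on positive reals.\<close>
  define R\<^sub>1 where "R\<^sub>1 = max M\<^sub>0 N"
  have R\<^sub>1: "0 < R\<^sub>1"
    using MC by (simp add: R\<^sub>1_def)
  define h where "h r = ln (max_modulus r f)" for r
  have gt1: "1 < max_modulus r f" if "R\<^sub>1 \<le> r" for r
    using that N by (simp add: R\<^sub>1_def)
  have h_grow: "C\<^sub>2 * h r \<le> h (C\<^sub>1 * r)" if r: "R\<^sub>1 \<le> r" for r
  proof -
    have "1 * r \<le> C\<^sub>1 * r"
      using r R\<^sub>1 MC by (intro mult_right_mono) auto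
    then have "1 < max_modulus (C\<^sub>1 * r) f"
      using r by (intro gt1) simp
    then show ?thesis
      using grow[of r] gt1[OF r] r by (simp add: R\<^sub>1_def ext_ln_def h_def)
  qed
  have h_mono: "h r \<le> h s" if "0 \<le> r" "r \<le> s" "R\<^sub>1 \<le> r" for r s
    unfolding h_def using gt1[OF that(3)] max_modulus_mono[OF holo that(1,2)]
    by (intro ln_mono) auto
  have h_pos: "0 < h r" if "R\<^sub>1 \<le> r" for r
    unfolding h_def by (rule ln_gt_zero[OF gt1[OF that]])
  have h_sq: "\<forall>\<^sub>F r in at_top. L * h r \<le> h (r\<^sup>2)" for L
    using growth_square[where h = h, OF MC(2,3) R\<^sub>1] h_grow h_mono h_pos by blast
  have h_ln: "\<forall>\<^sub>F r in at_top. ln (2 * r) \<le> h r"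
    using growth_ge_ln[where h = h, OF MC(2,3) R\<^sub>1] h_grow h_mono h_pos by blast
  obtain S where S: "S > 2" and
    gap: "\<forall>\<^sub>F r in at_top. \<exists>t. r\<^sup>2 < t \<and> t < r powr S \<and> t \<notin> exceptional_radii f \<epsilon>"
    using upper_log_dens_gap[OF borel_exceptional_radii[OF holomorphic_on_imp_continuous_on[OF holo]]
        dens \<epsilon>\<^sub>1] by blast
  have "\<forall>\<^sub>F r in at_top. 2 \<le> r \<and> 1 < max_modulus r f \<and> 2 * r \<le> max_modulus r f \<and>
      (\<exists>t. r\<^sup>2 < t \<and> t < r powr S \<and> t \<notin> exceptional_radii f \<epsilon>) \<and>
      S / \<epsilon> * ln (max_modulus r f) \<le> ln (max_modulus (r\<^sup>2) f)"
    using gap h_ln h_sq[of "S / \<epsilon>"] eventually_ge_at_top[of 2] eventually_ge_at_top[of R\<^sub>1]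
  proof eventually_elim
    case (elim r)
    have "2 * r \<le> max_modulus r f"
      using elim(2,4) gt1[OF elim(5)] by (simp add: h_def)
    with elim gt1[OF elim(5)] show ?case
      by (simp add: h_def)
  qed
  \<comment> \<open>One threshold serves for all asymptotic conditions at once.\<close>
  then obtain R' where R': "\<And>r. R' \<le> r \<Longrightarrow> 2 \<le> r \<and> 1 < max_modulus r f \<and> 2 * r \<le> max_modulus r f \<and>
      (\<exists>t. r\<^sup>2 < t \<and> t < r powr S \<and> t \<notin> exceptional_radii f \<epsilon>) \<and>
      S / \<epsilon> * ln (max_modulus r f) \<le> ln (max_modulus (r\<^sup>2) f)"
    unfolding eventually_at_top_linorder by blast
  have R'2: "2 \<le> R'"
    using R'[of R'] by simp
  have spread: "cmod b < max (cmod a) R' powr S"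
    if "U \<in> components (fatou_set f)" "a \<in> U" "b \<in> U" for U a b
    by (rule fatou_component_spread[OF holo R'2 S \<epsilon> _ _ _ _ _ that])
       (use R' h_sq in \<open>auto simp: h_def\<close>)
  have "B1 f < \<infinity>"
  \<comment> \<open>The exponent \<open>S + 1\<close> absorbs the summand 3 next to
    \<open>cmod z\<close>; the factor \<open>1 + ln (R' + 3)\<close> accounts for points
    \<open>w\<close> of modulus below \<open>R'\<close>.\<close>
  proof (rule B1_finiteI[where C = "(S + 1) * (1 + ln (R' + 3))"])
    fix U z w assume U: "U \<in> components (fatou_set f)" "z \<in> U" "w \<in> U"
    define x where "x = max (cmod w) R' + 3"
    have x: "3 \<le> x" "x \<le> (cmod w + 3) * (R' + 3)"
      using R'2 by (auto simp: x_def max_def algebra_simps)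
    have "cmod z < max (cmod w) R' powr S"
      using spread U by blast
    also have "\<dots> \<le> x powr S"
      using S R'2 by (intro powr_mono2) (auto simp: x_def)
    finally have "cmod z + 3 \<le> x powr S + x powr 1"
      using x by simp
    also have "\<dots> \<le> x powr S + x powr S"
      using x S by (intro add_left_mono powr_mono) auto
    also have "\<dots> = 2 * x powr S"
      by simp
    also have "\<dots> \<le> x * x powr S"
      using x by (intro mult_right_mono) auto
    also have "\<dots> = x powr (S + 1)"
      using x by (simp add: powr_add)
    finally have "ln (cmod z + 3) \<le> ln (x powr (S + 1))"
      by (intro ln_mono) (auto intro: add_nonneg_pos)
    also have "\<dots> = (S + 1) * ln x"
      using x by (simp add: ln_powr)
    also have "\<dots> \<le> (S + 1) * ((1 + ln (R' + 3)) * ln (cmod w + 3))"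
    proof (rule mult_left_mono)
      have "1 \<le> ln (cmod w + 3)"
        \<comment> \<open>This lower bound turns the additive constant \<open>ln (R' + 3)\<close>
          into a multiplicative one.\<close>
        using ln3_gt_1 ln_mono[of 3 "cmod w + 3"] by simp
      moreover have "0 \<le> ln (R' + 3)"
        using R'2 by simp
      ultimately have "ln (R' + 3) * 1 \<le> ln (R' + 3) * ln (cmod w + 3)"
        by (intro mult_left_mono)
      moreover have "ln x \<le> ln ((cmod w + 3) * (R' + 3))"
        using x by (intro ln_mono) auto
      moreover have "\<dots> = ln (cmod w + 3) + ln (R' + 3)"
        using R'2 by (intro ln_mult_pos add_nonneg_pos) auto
      ultimately show "ln x \<le> (1 + ln (R' + 3)) * ln (cmod w + 3)"
        by (simp add: algebra_simps)
    qed (use S in simp)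
    finally show "ln (cmod z + 3) \<le> (S + 1) * (1 + ln (R' + 3)) * ln (cmod w + 3)"
      by (simp add: mult.assoc)
  qed
  then show ?thesis
    by (simp add: strongly_uniformly_bounded_fatou_def)
qed

end
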